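(* Let $0\le c<1$ and let $(p_n)_{n\ge1}$ be a sequence in $[0,1]$ with $p_n=\Omega(n^{-c})$, and for each $n$ let $G_n$ be a random directed acyclic graph drawn from $D(n,p_n)$. Then for all $\epsilon>0$ and $\delta>0$ there exists $N$ such that for all $n\ge N$, $$P[\mathrm{GAPVS}(G_n)<1+\delta]>1-\epsilon.$$
   Context: $p_n=\Omega(n^{-c})$ means there exist $k>0$ and $n_0$ with $p_n \ge k n^{-c}$ for all $n\ge n_0$. The distribution $D(n,p)$ on directed acyclic graphs with vertex set $\{1,\dots,n\}$ is obtained by including each of the $\binom{n}{2}$ pairs $\{i,j\}$ independently with probability $p$ and orienting each included edge from $i$ to $j$ when $i<j$. For a directed acyclic graph $G=(V,E)$ with $|V|=n$, a layout is a bijection $\phi:V\to\{1,\dots,n\}$ such that $\phi(u)<\phi(v)$ for every directed edge $(u,v)\in E$ (a topological ordering). For $1\le i\le n$, let $\sigma(i,\phi,G)$ be the number of vertices $u$ with $\phi(u)\le i$ for which there exists $v$ with $\phi(v)>i$ joined to $u$ by an edge of $G$. Define $\mathrm{VS}(G,\phi)=\max_{1\le i\le n}\sigma(i,\phi,G)$, $\mathrm{MINVS}(G)=\min_\phi\mathrm{VS}(G,\phi)$, $\mathrm{MAXVS}(G)=\max_\phi\mathrm{VS}(G,\phi)$ over all layouts $\phi$ of $G$, and $\mathrm{GAPVS}(G)=\mathrm{MAXVS}(G)/\mathrm{MINVS}(G)$. *)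

theory Defs
  imports "HOL-Probability.Probability" "Graph_Theory.Pair_Digraph"
begin

text \<open>
  The pair type of \<^theory>\<open>Graph_Theory.Pair_Digraph\<close> represents \<open>G = (V, E)\<close>, with
  \<^term>\<open>pverts G\<close> as \<open>V\<close> and \<^term>\<open>parcs G\<close> as \<open>E\<close>. Membership of the layout in the extensional
  function space makes a layout determined by its values on the vertices.
\<close>

definition layouts :: "'a pair_pre_digraph \<Rightarrow> ('a \<Rightarrow> nat) set" where
  "layouts G = {\<phi> \<in> pverts G \<rightarrow>\<^sub>E {1..card (pverts G)}.
     bij_betw \<phi> (pverts G) {1..card (pverts G)} \<and> (\<forall>(u, v) \<in> parcs G. \<phi> u < \<phi> v)}"

definition sigma_vs :: "nat \<Rightarrow> ('a \<Rightarrow> nat) \<Rightarrow> 'a pair_pre_digraph \<Rightarrow> nat" where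
  "sigma_vs i \<phi> G = card {u \<in> pverts G. \<phi> u \<le> i \<and>
     (\<exists>v \<in> pverts G. \<phi> v > i \<and> ((u, v) \<in> parcs G \<or> (v, u) \<in> parcs G))}"

definition VS :: "'a pair_pre_digraph \<Rightarrow> ('a \<Rightarrow> nat) \<Rightarrow> nat" where
  "VS G \<phi> = Max ((\<lambda>i. sigma_vs i \<phi> G) ` {1..card (pverts G)})"

definition MINVS :: "'a pair_pre_digraph \<Rightarrow> nat" where
  "MINVS G = Min (VS G ` layouts G)"

definition MAXVS :: "'a pair_pre_digraph \<Rightarrow> nat" where
  "MAXVS G = Max (VS G ` layouts G)"

text \<open>
  For an acyclic graph without edges both quantities vanish and the quotient is \<open>0 / 0\<close>, which
  is \<open>0\<close> in HOL; in all other cases the denominator is positive.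
\<close>

definition GAPVS :: "'a pair_pre_digraph \<Rightarrow> real" where
  "GAPVS G = real (MAXVS G) / real (MINVS G)"

definition random_dag :: "nat \<Rightarrow> real \<Rightarrow> nat pair_pre_digraph pmf" where
  "random_dag n p =
     map_pmf (\<lambda>X. \<lparr>pverts = {1..n},
                    parcs = {(i, j). i \<in> {1..n} \<and> j \<in> {1..n} \<and> i < j \<and> X {i, j}}\<rparr>)
       (Pi_pmf {e. e \<subseteq> {1..n} \<and> card e = 2} False (\<lambda>_. bernoulli_pmf p))"

lemma finite_layouts: "finite (pverts G) \<Longrightarrow> finite (layouts G)"
  unfolding layouts_def by (rule finite_subset[of _ "pverts G \<rightarrow>\<^sub>E {1..card (pverts G)}"])
    (auto intro: finite_PiE)

lemma random_dag_verts: "G \<in> set_pmf (random_dag n p) \<Longrightarrow> pverts G = {1..n}"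
  by (auto simp: random_dag_def)

lemma random_dag_acyclic:
  assumes "G \<in> set_pmf (random_dag n p)"
  shows "acyclic (parcs G)"
  by (rule acyclic_subset[of "{(i, j). i < j}"])
    (use assms in \<open>auto simp: random_dag_def intro!: wf_acyclic wf\<close>)

lemma random_dag_layouts_nonempty:
  assumes "G \<in> set_pmf (random_dag n p)"
  shows "layouts G \<noteq> {}"
proof -
  have "restrict id {1..n} \<in> layouts G"
    using assms by (auto simp: random_dag_def layouts_def bij_betw_def inj_on_def)
  then show ?thesis by blast
qed

end

theory Submission
  imports Defs "HOL-Real_Asymp.Real_Asymp"
begin

text \<open>
  Trivially \<open>MAXVS \<le> n\<close>, so it suffices that every layout has vertex separation close to \<open>n\<close>.
  Suppose that any two disjoint vertex sets of size \<open>m\<close> are joined by an edge, and cut a layout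
  after \<open>n - m\<close> vertices. Fewer than \<open>m\<close> of these vertices have no neighbour among the last \<open>m\<close>,
  hence the vertex separation exceeds \<open>n - 2 m\<close>. By the union bound, the assumption fails with
  probability at most \<open>4 ^ n * (1 - p) ^ (m\<^sup>2)\<close>, and for \<open>m\<close> linear in \<open>n\<close> and \<open>p \<ge> k * n powr (- c)\<close>
  this tends to \<open>0\<close>, because \<open>2 - c > 1\<close>.
\<close>

text \<open>A bipartite hole of the underlying undirected graph: both orientations are excluded,
  matching \<open>sigma_vs\<close>. No layout occurs in it, so the union bound runs over pairs of
  vertex sets rather than over orderings.\<close>

definition bipartite_hole :: "nat \<Rightarrow> 'a pair_pre_digraph \<Rightarrow> bool" where
  "bipartite_hole m G \<longleftrightarrow> (\<exists>A B. A \<subseteq> pverts G \<and> B \<subseteq> pverts G \<and> A \<inter> B = {} \<and>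
     card A = m \<and> card B = m \<and> (\<forall>a\<in>A. \<forall>b\<in>B. (a, b) \<notin> parcs G \<and> (b, a) \<notin> parcs G))"

lemma VS_gt_if_no_bipartite_hole:
  assumes fin: "finite (pverts G)" and \<phi>: "\<phi> \<in> layouts G"
    and m: "m < card (pverts G)" and no_hole: "\<not> bipartite_hole m G"
  shows "card (pverts G) < VS G \<phi> + 2 * m"
proof -
  define V n where "V = pverts G" and "n = card V"
  define L where "L = {u \<in> V. \<phi> u > n - m}"
  define S where "S = {u \<in> V. \<phi> u \<le> n - m \<and>
    (\<exists>v\<in>V. \<phi> v > n - m \<and> ((u, v) \<in> parcs G \<or> (v, u) \<in> parcs G))}"
  define T where "T = V - L - S"
  have bij: "bij_betw \<phi> V {1..n}" using \<phi> by (simp add: layouts_def V_def n_def)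
  have "\<phi> ` L = \<phi> ` V \<inter> {n - m<..}" by (auto simp: L_def)
  also have "\<dots> = {n - m<..n}" unfolding bij_betw_imp_surj_on[OF bij] by auto
  finally have "card (\<phi> ` L) = m" using m by (simp add: n_def V_def)
  moreover have "inj_on \<phi> L"
    by (rule inj_on_subset[OF bij_betw_imp_inj_on[OF bij]]) (auto simp: L_def)
  ultimately have cardL: "card L = m" by (simp add: card_image)
  have cardT: "card T < m"
  proof (rule ccontr)
    assume "\<not> card T < m"
    then obtain A where A: "A \<subseteq> T" "card A = m"
      by (meson not_less obtain_subset_with_card_n)
    have "bipartite_hole m G"
      unfolding bipartite_hole_def
      by (rule exI[of _ A], rule exI[of _ L])
        (use A cardL in \<open>auto simp: T_def S_def L_def V_def\<close>)
    with no_hole show False by contradiction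
  qed
  have "V = L \<union> S \<union> T" by (auto simp: T_def L_def S_def)
  then have "n \<le> card L + card S + card T"
    unfolding n_def by (metis add_le_cancel_right card_Un_le order_trans)
  moreover have "card S \<le> VS G \<phi>"
    unfolding VS_def
  proof (rule Max_ge)
    have "card S = sigma_vs (n - m) \<phi> G" by (simp add: S_def sigma_vs_def V_def)
    \<comment> \<open>Here \<open>m < n\<close> is what puts the cut at position 1 or later, inside
      the range of the maximum.\<close>
    moreover have "n - m \<in> {1..card (pverts G)}" using m by (auto simp: n_def V_def)
    ultimately show "card S \<in> (\<lambda>i. sigma_vs i \<phi> G) ` {1..card (pverts G)}" by blast
  qed auto
  ultimately show ?thesis using cardL cardT by (simp add: n_def V_def)
qed

lemma VS_le_card:
  assumes "finite (pverts G)" "pverts G \<noteq> {}"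
  shows "VS G \<phi> \<le> card (pverts G)"
  unfolding VS_def
proof (rule Max.boundedI)
  show "(\<lambda>i. sigma_vs i \<phi> G) ` {1..card (pverts G)} \<noteq> {}"
    using assms by (auto simp: Suc_le_eq card_gt_0_iff)
qed (auto simp: sigma_vs_def intro!: card_mono assms)

text \<open>The quotient is below \<open>n / (n - 2 * m)\<close>, where \<open>n\<close> is the
  number of vertices, and the hypothesis on \<open>m\<close> is a rearrangement of
  \<open>n < (1 + \<delta>) * (n - 2 * m)\<close>.\<close>

lemma GAPVS_less_if_no_bipartite_hole:
  assumes fin: "finite (pverts G)" and ne: "layouts G \<noteq> {}"
    and no_hole: "\<not> bipartite_hole m G" and "\<delta> > 0"
    and m: "2 * (1 + \<delta>) * real m < \<delta> * real (card (pverts G))"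
  shows "GAPVS G < 1 + \<delta>"
proof -
  let ?n = "card (pverts G)"
  have "2 * (1 + \<delta>) * real m < (1 + \<delta>) * real ?n"
    by (rule less_le_trans[OF m]) (simp add: algebra_simps)
  then have "(1 + \<delta>) * (2 * real m) < (1 + \<delta>) * real ?n" by (simp add: algebra_simps)
  then have "2 * real m < real ?n" using \<open>\<delta> > 0\<close> by (simp only: mult_less_cancel_left_pos)
  then have m': "2 * m < ?n" by linarith
  then have V: "pverts G \<noteq> {}" by auto
  have finVS: "finite (VS G ` layouts G)" by (simp add: fin finite_layouts)
  have max: "MAXVS G \<le> ?n"
    unfolding MAXVS_def using finVS ne VS_le_card[OF fin V] by (subst Max_le_iff) auto
  have "?n < MINVS G + 2 * m"
  proof -
    have "MINVS G \<in> VS G ` layouts G"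
      unfolding MINVS_def using finVS ne by (intro Min_in) auto
    then show ?thesis using VS_gt_if_no_bipartite_hole[OF fin _ _ no_hole] m' by auto
  qed
  then have min: "real ?n - 2 * real m < real (MINVS G)" by linarith
  \<comment> \<open>This excludes the default value of \<open>0 / 0\<close>, so the quotient can be
    cleared.\<close>
  have pos: "real (MINVS G) > 0" using min m' by linarith
  have "real (MAXVS G) \<le> real ?n" using max by simp
  also have "\<dots> < (1 + \<delta>) * (real ?n - 2 * real m)" using m by (simp add: algebra_simps)
  also have "\<dots> \<le> (1 + \<delta>) * real (MINVS G)" using min \<open>\<delta> > 0\<close> by (intro mult_left_mono) auto
  finally show ?thesis using pos by (simp add: GAPVS_def pos_divide_less_eq)
qed

text \<open>The event is a product set that constrains only the coordinates in \<open>F\<close>. By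
  independence each of these contributes a factor \<open>1 - p\<close> and every other coordinate of
  \<open>E\<close> a factor 1.\<close>

lemma prob_Pi_bernoulli_all_False:
  assumes "finite E" "F \<subseteq> E" "0 \<le> p" "p \<le> 1"
  shows "measure_pmf.prob (Pi_pmf E False (\<lambda>_. bernoulli_pmf p)) {X. \<forall>e\<in>F. \<not> X e} =
    (1 - p) ^ card F"
proof -
  let ?B = "\<lambda>e. if e \<in> F then {False} else UNIV"
  have "{X. \<forall>e\<in>F. \<not> X e} = Pi E ?B"
    using assms(2) by (auto simp: Pi_def)
  then have "measure_pmf.prob (Pi_pmf E False (\<lambda>_. bernoulli_pmf p)) {X. \<forall>e\<in>F. \<not> X e} =
      (\<Prod>e\<in>E. measure_pmf.prob (bernoulli_pmf p) (?B e))"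
    using assms(1) by (simp only: measure_Pi_pmf_Pi)
  also have "\<dots> = (\<Prod>e\<in>E. if e \<in> F then 1 - p else 1)"
    using assms by (intro prod.cong) (auto simp: measure_pmf_single)
  also have "\<dots> = (\<Prod>e\<in>F. 1 - p)"
    using assms by (simp add: prod.If_cases Int_absorb1)
  finally show ?thesis by simp
qed

text \<open>There are at most \<open>2 ^ n * 2 ^ n\<close> ordered pairs of sets, and a given
  disjoint pair is a hole only if \<open>m\<^sup>2\<close> distinct potential edges are all
  absent.\<close>

lemma prob_bipartite_hole_le:
  assumes p: "0 \<le> p" "p \<le> 1"
  shows "measure_pmf.prob (random_dag n p) {G. bipartite_hole m G} \<le> 4 ^ n * (1 - p) ^ m\<^sup>2"
proof -
  define E where "E = {e. e \<subseteq> {1..n} \<and> card e = 2}"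
  define P where "P = {(A, B). A \<subseteq> {1..n} \<and> B \<subseteq> {1..n} \<and> A \<inter> B = {} \<and> card A = m \<and> card B = m}"
  define F where "F = (\<lambda>(A, B). (\<lambda>(a, b). {a, b}) ` (A \<times> B) :: nat set set)"
  let ?M = "Pi_pmf E False (\<lambda>_. bernoulli_pmf p)"
  let ?G = "\<lambda>X. \<lparr>pverts = {1..n},
    parcs = {(i, j). i \<in> {1..n} \<and> j \<in> {1..n} \<and> i < j \<and> X {i, j}}\<rparr>"
  have finE: "finite E"
    unfolding E_def by (rule finite_subset[of _ "Pow {1..n}"]) auto
  have P_sub: "P \<subseteq> Pow {1..n} \<times> Pow {1..n}" by (auto simp: P_def)
  have finP: "finite P" by (rule finite_subset[OF P_sub]) auto
  have "card P \<le> card (Pow {1..n} \<times> Pow {1..n})"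
    by (rule card_mono[OF _ P_sub]) auto
  then have "card P \<le> 2 ^ n * 2 ^ n"
    by (simp add: card_cartesian_product card_Pow)
  then have "card P \<le> 4 ^ n" by (simp flip: power_mult_distrib)
  then have cardP: "real (card P) \<le> 4 ^ n"
    by (metis of_nat_le_iff of_nat_numeral of_nat_power)
  have prob_F: "measure_pmf.prob ?M {X. \<forall>e\<in>F q. \<not> X e} = (1 - p) ^ m\<^sup>2" if q: "q \<in> P" for q
  proof -
    obtain A B where AB: "q = (A, B)" "A \<subseteq> {1..n}" "B \<subseteq> {1..n}" "A \<inter> B = {}"
      "card A = m" "card B = m"
      using q by (auto simp: P_def)
    \<comment> \<open>If \<open>{a, b} = {a', b'}\<close> with the roles swapped, then
      \<open>a = b'\<close> would lie in both \<open>A\<close> and \<open>B\<close>.\<close>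
    have "inj_on (\<lambda>(a, b). {a, b}) (A \<times> B)"
      using AB(4) by (auto simp: inj_on_def doubleton_eq_iff)
    then have "card (F q) = m\<^sup>2"
      using AB by (simp add: F_def card_image card_cartesian_product power2_eq_square)
    moreover have "F q \<subseteq> E"
    proof -
      have "a \<noteq> b" if "a \<in> A" "b \<in> B" for a b using AB(4) that by auto
      then show ?thesis using AB(2,3) by (auto simp: AB(1) F_def E_def)
    qed
    ultimately show ?thesis by (simp add: prob_Pi_bernoulli_all_False[OF finE _ p])
  qed
  have "?G -` {G. bipartite_hole m G} \<subseteq> (\<Union>q\<in>P. {X. \<forall>e\<in>F q. \<not> X e})"
  proof
    fix X assume "X \<in> ?G -` {G. bipartite_hole m G}"
    then obtain A B where AB: "A \<subseteq> {1..n}" "B \<subseteq> {1..n}" "A \<inter> B = {}" "card A = m" "card B = m"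
      and no: "\<forall>a\<in>A. \<forall>b\<in>B. (a, b) \<notin> parcs (?G X) \<and> (b, a) \<notin> parcs (?G X)"
      by (auto simp: bipartite_hole_def)
    have "\<not> X {a, b}" if "a \<in> A" "b \<in> B" for a b
    proof -
      have "a \<noteq> b" "a \<in> {1..n}" "b \<in> {1..n}" using AB that by auto
      moreover have "(a, b) \<notin> parcs (?G X)" "(b, a) \<notin> parcs (?G X)" using no that by blast+
      \<comment> \<open>Arcs point from the smaller to the larger number, so exactly one of the two
        missing arcs tells that the coordinate \<open>{a, b}\<close> is \<open>False\<close>; the
        order of \<open>a\<close> and \<open>b\<close> decides which.\<close>
      ultimately show ?thesis by (cases "a < b") (auto simp: insert_commute)
    qed
    then have "X \<in> {X. \<forall>e\<in>F (A, B). \<not> X e}" by (auto simp: F_def)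
    moreover have "(A, B) \<in> P" using AB by (simp add: P_def)
    ultimately show "X \<in> (\<Union>q\<in>P. {X. \<forall>e\<in>F q. \<not> X e})" by blast
  qed
  then have "measure_pmf.prob ?M (?G -` {G. bipartite_hole m G}) \<le>
      measure_pmf.prob ?M (\<Union>q\<in>P. {X. \<forall>e\<in>F q. \<not> X e})"
    by (intro measure_pmf.finite_measure_mono) auto
  also have "\<dots> \<le> (\<Sum>q\<in>P. measure_pmf.prob ?M {X. \<forall>e\<in>F q. \<not> X e})"
    by (intro measure_pmf.finite_measure_subadditive_finite finP) auto
  also have "\<dots> = real (card P) * (1 - p) ^ m\<^sup>2" by (simp add: prob_F)
  also have "\<dots> \<le> 4 ^ n * (1 - p) ^ m\<^sup>2" using cardP p by (intro mult_right_mono) auto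
  finally show ?thesis by (simp add: random_dag_def E_def)
qed

theorem theorem6:
  fixes c :: real and p :: "nat \<Rightarrow> real"
  assumes "0 \<le> c" and "c < 1"
    and "\<forall>n\<ge>1. 0 \<le> p n \<and> p n \<le> 1"
    and "\<exists>k>0. \<exists>n\<^sub>0. \<forall>n\<ge>n\<^sub>0. p n \<ge> k * real n powr (- c)"
  shows "\<forall>\<epsilon>>0. \<forall>\<delta>>0. \<exists>N. \<forall>n\<ge>N.
    measure_pmf.prob (random_dag n (p n)) {G. GAPVS G < 1 + \<delta>} > 1 - \<epsilon>"
proof (intro allI impI)
  fix \<epsilon> \<delta> :: real
  assume "\<epsilon> > 0" "\<delta> > 0"
  obtain k n\<^sub>0 where "k > 0" and k: "\<And>n. n \<ge> n\<^sub>0 \<Longrightarrow> p n \<ge> k * real n powr (- c)"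
    using assms(4) by blast
  \<comment> \<open>With this choice \<open>2 * (1 + \<delta>) * (a * n)\<close> equals
    \<open>\<delta> / 2 * n\<close>. The other half of \<open>\<delta> * n\<close> absorbs the
    rounding when \<open>m\<close> is taken as the ceiling of \<open>a * n\<close>.\<close>
  define a where "a = \<delta> / (4 * (1 + \<delta>))"
  \<comment> \<open>The constant in \<open>p n * m\<^sup>2 \<ge> k * n powr (- c) * (a * n)\<^sup>2
    = K * n powr (2 - c)\<close>.\<close>
  define K where "K = k * a\<^sup>2"
  have "a > 0" using \<open>\<delta> > 0\<close> by (simp add: a_def)
  have "K > 0" using \<open>a > 0\<close> \<open>k > 0\<close> by (simp add: K_def)
  have "(\<lambda>n::nat. 4 ^ n * exp (- (K * real n powr (2 - c)))) \<longlonglongrightarrow> 0"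
    using \<open>K > 0\<close> \<open>c < 1\<close> by real_asymp
  then have "\<forall>\<^sub>F n in sequentially. 4 ^ n * exp (- (K * real n powr (2 - c))) < \<epsilon>"
    using \<open>\<epsilon> > 0\<close> by (rule order_tendstoD)
  moreover have "\<forall>\<^sub>F n::nat in sequentially. 2 * (1 + \<delta>) < \<delta> / 2 * real n"
    using \<open>\<delta> > 0\<close> by real_asymp
  moreover have "\<forall>\<^sub>F n in sequentially. n \<ge> max 1 n\<^sub>0" by (rule eventually_ge_at_top)
  ultimately have "\<forall>\<^sub>F n in sequentially.
      measure_pmf.prob (random_dag n (p n)) {G. GAPVS G < 1 + \<delta>} > 1 - \<epsilon>"
  proof eventually_elim
    case (elim n)
    define m where "m = nat \<lceil>a * real n\<rceil>"
    have n: "n \<ge> 1" "n \<ge> n\<^sub>0" using elim(3) by auto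
    have p: "0 \<le> p n" "p n \<le> 1" using assms(3) n by auto
    have m_ge: "a * real n \<le> real m" by (simp add: m_def real_nat_ceiling_ge)
    have "0 \<le> a * real n" using \<open>a > 0\<close> by simp
    then have "real m \<le> a * real n + 1" unfolding m_def by linarith
    then have "2 * (1 + \<delta>) * real m \<le> 2 * (1 + \<delta>) * (a * real n + 1)"
      using \<open>\<delta> > 0\<close> by (intro mult_left_mono) auto
    also have "\<dots> = \<delta> / 2 * real n + 2 * (1 + \<delta>)"
      using \<open>\<delta> > 0\<close> by (simp add: a_def divide_simps)
    also have "\<dots> < \<delta> * real n" using elim(2) by simp
    finally have m_less: "2 * (1 + \<delta>) * real m < \<delta> * real n" .
    let ?M = "random_dag n (p n)"
    have "K * real n powr (2 - c) = (k * real n powr (- c)) * (a * real n)\<^sup>2"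
      using n by (simp add: K_def powr_diff powr_minus power_mult_distrib field_simps)
    also have "\<dots> \<le> p n * (real m)\<^sup>2"
      using k[OF n(2)] m_ge \<open>a > 0\<close> p by (intro mult_mono power_mono) auto
    finally have exponent: "K * real n powr (2 - c) \<le> p n * real (m\<^sup>2)" by simp
    \<comment> \<open>This is \<open>1 + x \<le> exp x\<close> at \<open>x = - p n\<close>; raising
      it to a power uses \<open>p n \<le> 1\<close>.\<close>
    have "(1 - p n) ^ m\<^sup>2 \<le> exp (- p n) ^ m\<^sup>2"
      using p exp_ge_add_one_self[of "- p n"] by (intro power_mono) auto
    also have "\<dots> = exp (- (p n * real (m\<^sup>2)))"
      by (simp add: exp_of_nat_mult[symmetric] mult.commute)
    also have "\<dots> \<le> exp (- (K * real n powr (2 - c)))" using exponent by simp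
    finally have "4 ^ n * (1 - p n) ^ m\<^sup>2 \<le> 4 ^ n * exp (- (K * real n powr (2 - c)))"
      by simp
    then have hole: "measure_pmf.prob ?M {G. bipartite_hole m G} < \<epsilon>"
      using prob_bipartite_hole_le[OF p, of n m] elim(1) by linarith
    have "1 - \<epsilon> < measure_pmf.prob ?M (- {G. bipartite_hole m G})"
      using hole measure_pmf.prob_compl[of "{G. bipartite_hole m G}" ?M]
      by (simp add: Compl_eq_Diff_UNIV)
    also have "\<dots> \<le> measure_pmf.prob ?M {G. GAPVS G < 1 + \<delta>}"
    \<comment> \<open>The inclusion of events is shown only on the support, where the vertex set is
      \<open>{1..n}\<close> and a layout exists.\<close>
    proof (rule measure_pmf.finite_measure_mono_AE)
      show "AE G in ?M. G \<in> - {G. bipartite_hole m G} \<longrightarrow> G \<in> {G. GAPVS G < 1 + \<delta>}"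
        unfolding AE_measure_pmf_iff
        using random_dag_verts random_dag_layouts_nonempty m_less \<open>\<delta> > 0\<close>
        by (auto intro!: GAPVS_less_if_no_bipartite_hole[of _ m])
    qed auto
    finally show ?case .
  qed
  then show "\<exists>N. \<forall>n\<ge>N. measure_pmf.prob (random_dag n (p n)) {G. GAPVS G < 1 + \<delta>} > 1 - \<epsilon>"
    by (simp add: eventually_sequentially)
qed

end
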